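(* Let $n\ge3$, $\frac{\sqrt{n-1}}2<t\le\frac{\sqrt n}2$, and $a^{[n]}:=\frac1{\sqrt n}(1,\dots,1)\in S^{n-1}$. Then for all $a\in S^{n-1}$, $$A(a,t)\le A(a^{[n]},t)=\frac{n^{n/2}}{(n-1)!}\Big(\frac{\sqrt n}2-t\Big)^{n-1}.$$ For $n=2$ the same inequality holds for $\frac38\sqrt2<t\le\frac1{\sqrt2}$, and it fails for some $a$ when $\frac12<t<\frac38\sqrt2$.
   Context: $Q^n=[-\frac12,\frac12]^n\subset\mathbb{R}^n$ is the unit-volume cube. For $a\in S^{n-1}$, $t\in\mathbb{R}$, $H_t(a)=\{x\in\mathbb{R}^n:\langle a,x\rangle=t\}$ and $A(a,t)=\mathrm{vol}_{n-1}(H_t(a)\cap Q^n)$. *)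

theory Defs
  imports "HOL-Analysis.Analysis"
begin

definition cube :: "'a::euclidean_space set" where
  "cube = {x. \<forall>i\<in>Basis. \<bar>x \<bullet> i\<bar> \<le> 1/2}"

definition hyperplane :: "'a::euclidean_space \<Rightarrow> real \<Rightarrow> 'a set" where
  "hyperplane a t = {x. a \<bullet> x = t}"

text \<open>(n-1)-dimensional Lebesgue measure of a set S lying in a hyperplane with
  unit normal a: the induced Lebesgue measure on the hyperplane, realised via the
  product decomposition R^n = a^perp x R a, i.e. as the n-dimensional Lebesgue measure
  of the right cylinder of height 1 over S in direction a.\<close>
definition hvol :: "'a::euclidean_space \<Rightarrow> 'a set \<Rightarrow> real" where
  "hvol a S = measure lebesgue {x + s *\<^sub>R a | x s. x \<in> S \<and> s \<in> {0..1}}"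

definition sec_area :: "'a::euclidean_space \<Rightarrow> real \<Rightarrow> real" where
  "sec_area a t = hvol a (hyperplane a t \<inter> cube)"

definition diagvec :: "real ^ 'n" where
  "diagvec = (\<chi> i. 1 / sqrt (real CARD('n)))"

end

theory Submission
  imports Defs
begin

text \<open>
  By reflections in the coordinate hyperplanes all coordinates of \<open>a\<close> may be taken nonnegative. Since
  \<open>t > \<surd>(n-1)/2\<close>, the hyperplane can only cut off the corner \<open>(1/2,\<dots>,1/2)\<close> of the cube, so with
  \<open>\<sigma> = \<Sum>a\<^sub>i\<close> the section is empty (\<open>\<sigma> < 2t\<close>) or a simplex of volume
  \<open>(\<sigma>/2 - t)\<^sup>n\<^sup>-\<^sup>1 / ((n-1)! \<Prod>a\<^sub>i)\<close>.

  For \<open>n \<ge> 3\<close> the quotient \<open>(\<sigma> - 2t) / (\<surd>n - 2t)\<close> decreases in \<open>t\<close>, which reduces the claim to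
  \<open>t = \<surd>(n-1)/2\<close>. Put \<open>b\<^sub>i = \<surd>n a\<^sub>i\<close> with mean \<open>\<beta>\<close>, \<open>q = \<surd>(1-1/n)\<close> and \<open>1 - x\<^sup>2 = (\<beta>-q)/(1-q)\<close>; the claim
  becomes \<open>(1-x\<^sup>2)\<^sup>n\<^sup>-\<^sup>1 \<le> \<Prod>b\<^sub>i\<close>. Samuelson's inequality gives \<open>\<bar>b\<^sub>i - 1\<bar> \<le> x\<close>, and on this range
  \<open>ln b \<ge> (b-1) - c (b-1)\<^sup>2\<close>, where \<open>c\<close> is chosen so that equality holds at \<open>b = 1 - x\<close>. Summing over \<open>i\<close>
  turns the claim into an inequality in \<open>x\<close> alone.

  For \<open>n = 2\<close> the claim is equivalent to \<open>(\<surd>2 - 2t)(\<surd>2 + \<sigma>) \<le> 1\<close> for all attainable \<open>\<sigma> < \<surd>2\<close>.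
\<close>

section \<open>A lower bound for products\<close>

lemma ln_one_minus_remainder_scale_le:
  fixes l x :: real
  assumes "\<bar>l\<bar> \<le> 1" "0 \<le> x" "x < 1"
  shows "- ln (1 - l * x) - l * x \<le> l\<^sup>2 * (- ln (1 - x) - x)"
proof -
  define D where "D u = l\<^sup>2 * (- ln (1 - u) - u) - (- ln (1 - l * u) - l * u)" for u
  have "D 0 \<le> D x"
  proof (rule DERIV_nonneg_imp_nondecreasing[OF \<open>0 \<le> x\<close>])
    fix u assume u: "0 \<le> u" "u \<le> x"
    have "l * u \<le> 1 * u"
      using assms u by (intro mult_right_mono) auto
    then have less: "l * u \<le> u" "u < 1" "l * u < 1"
      using assms u by auto
    have "(D has_real_derivative l\<^sup>2 * u * (1 / (1 - u) - 1 / (1 - l * u))) (at u)"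
      unfolding D_def using less
      by (auto intro!: derivative_eq_intros simp: field_simps power2_eq_square)
    moreover have "1 / (1 - l * u) \<le> 1 / (1 - u)"
      using less by (intro divide_left_mono) auto
    ultimately show "\<exists>y. (D has_real_derivative y) (at u) \<and> 0 \<le> y"
      using u by (metis diff_ge_0_iff_ge mult_nonneg_nonneg zero_le_power2)
  qed
  then show ?thesis
    by (simp add: D_def)
qed

lemma ln_one_plus_ge_quadratic:
  fixes e x :: real
  assumes "\<bar>e\<bar> \<le> x" "x < 1"
  shows "e - (- ln (1 - x) - x) / x\<^sup>2 * e\<^sup>2 \<le> ln (1 + e)"
proof (cases "x = 0")
  case False
  then have "- ln (1 - (- e / x) * x) - (- e / x) * x \<le> (- e / x)\<^sup>2 * (- ln (1 - x) - x)"
    using assms by (intro ln_one_minus_remainder_scale_le) auto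
  then show ?thesis
    using False by (simp add: power_divide algebra_simps)
qed (use assms in simp)

lemma ln_prod_ge_quadratic:
  fixes b :: "'i \<Rightarrow> real"
  assumes "finite I" and near_one: "\<And>i. i \<in> I \<Longrightarrow> \<bar>b i - 1\<bar> \<le> x" and "x < 1"
  shows "(\<Sum>i\<in>I. b i - 1) - (- ln (1 - x) - x) / x\<^sup>2 * (\<Sum>i\<in>I. (b i - 1)\<^sup>2) \<le> ln (\<Prod>i\<in>I. b i)"
proof -
  let ?c = "(- ln (1 - x) - x) / x\<^sup>2"
  have pos: "0 < b i" if "i \<in> I" for i
    using near_one[OF that] \<open>x < 1\<close> by linarith
  have "(\<Sum>i\<in>I. b i - 1) - ?c * (\<Sum>i\<in>I. (b i - 1)\<^sup>2) = (\<Sum>i\<in>I. (b i - 1) - ?c * (b i - 1)\<^sup>2)"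
    by (simp only: sum_subtractf sum_distrib_left)
  also have "\<dots> \<le> (\<Sum>i\<in>I. ln (b i))"
    using ln_one_plus_ge_quadratic[OF near_one \<open>x < 1\<close>] by (intro sum_mono) simp
  also have "\<dots> = ln (\<Prod>i\<in>I. b i)"
    using \<open>finite I\<close> by (intro ln_prod[symmetric]) (auto dest: pos)
  finally show ?thesis .
qed

lemma mult_ln_one_minus_square_le:
  fixes m x :: real
  assumes "3 \<le> m" "0 \<le> x" "x < 1"
  shows "m * ln (1 - x\<^sup>2) \<le> 2 * x + 2 * ln (1 - x) - x\<^sup>2"
proof -
  define h where "h u = 2 * u - u\<^sup>2 - ln (1 - u) - 3 * ln (1 + u)" for u :: real
  have "h 0 \<le> h x"
  proof (rule DERIV_nonneg_imp_nondecreasing[OF \<open>0 \<le> x\<close>])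
    fix u assume u: "0 \<le> u" "u \<le> x"
    have "(h has_real_derivative 2 * u * ((1 - u) + u\<^sup>2) / ((1 - u) * (1 + u))) (at u)"
      unfolding h_def using u assms
      by (auto intro!: derivative_eq_intros simp: divide_simps) (simp add: algebra_simps power2_eq_square)
    moreover have "0 \<le> 2 * u * ((1 - u) + u\<^sup>2) / ((1 - u) * (1 + u))"
      using u assms by (intro divide_nonneg_nonneg mult_nonneg_nonneg add_nonneg_nonneg) auto
    ultimately show "\<exists>y. (h has_real_derivative y) (at u) \<and> 0 \<le> y"
      by blast
  qed
  moreover have "1 - x\<^sup>2 = (1 - x) * (1 + x)"
    by (simp add: power2_eq_square algebra_simps)
  then have "ln (1 - x\<^sup>2) = ln (1 - x) + ln (1 + x)"
    using assms by (simp add: ln_mult)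
  ultimately have "3 * ln (1 - x\<^sup>2) \<le> 2 * x + 2 * ln (1 - x) - x\<^sup>2"
    by (simp add: h_def)
  moreover have "x\<^sup>2 < 1"
    using assms by (simp add: power_less_one_iff)
  then have "m * ln (1 - x\<^sup>2) \<le> 3 * ln (1 - x\<^sup>2)"
    using \<open>3 \<le> m\<close> by (intro mult_right_mono_neg) auto
  ultimately show ?thesis
    by simp
qed

lemma Samuelson_inequality:
  fixes f :: "'i \<Rightarrow> real"
  assumes "finite I" "k \<in> I"
  shows "(card I * f k - (\<Sum>i\<in>I. f i))\<^sup>2
    \<le> (real (card I) - 1) * (card I * (\<Sum>i\<in>I. (f i)\<^sup>2) - (\<Sum>i\<in>I. f i)\<^sup>2)"
proof -
  define n s q where "n = real (card I)" and "s = (\<Sum>i\<in>I. f i)" and "q = (\<Sum>i\<in>I. (f i)\<^sup>2)"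
  have "card I > 0"
    using assms by (auto simp: card_gt_0_iff)
  then have card: "real (card (I - {k})) = n - 1"
    using assms by (simp add: n_def of_nat_diff)
  have "(\<Sum>i\<in>I - {k}. f i)\<^sup>2 \<le> (\<Sum>i\<in>I - {k}. (f i)\<^sup>2) * card (I - {k})"
    by (rule sum_squared_le_sum_of_squares)
  then have "(s - f k)\<^sup>2 \<le> (n - 1) * (q - (f k)\<^sup>2)"
    unfolding card using assms by (simp add: sum_diff1 s_def q_def mult.commute)
  then have "n * (s - f k)\<^sup>2 \<le> n * ((n - 1) * (q - (f k)\<^sup>2))"
    by (intro mult_left_mono) (auto simp: n_def)
  then have "(n * f k - s)\<^sup>2 \<le> (n - 1) * (n * q - s\<^sup>2)"
    by (simp add: power2_eq_square algebra_simps)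
  then show ?thesis
    by (simp add: n_def s_def q_def)
qed

lemma abs_diff_one_le_of_mean:
  fixes b q x \<beta> :: real
  assumes q: "0 \<le> q" "q < 1" and x: "0 \<le> x" "x \<le> 1" and \<beta>: "\<beta> = 1 - (1 - q) * x\<^sup>2"
    and deviation: "(1 - q\<^sup>2) * (b - \<beta>)\<^sup>2 \<le> q\<^sup>2 * (1 - \<beta>\<^sup>2)"
  shows "\<bar>b - 1\<bar> \<le> x"
proof -
  have "(1 - q\<^sup>2) * (x - (1 - \<beta>))\<^sup>2 - q\<^sup>2 * (1 - \<beta>\<^sup>2) = (1 - q)\<^sup>2 * x\<^sup>2 * ((1 - x) * (1 + 2 * q - x))"
    unfolding \<beta> by algebra
  also have "\<dots> \<ge> 0"
    using q x by (intro mult_nonneg_nonneg) auto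
  finally have "(1 - q\<^sup>2) * (b - \<beta>)\<^sup>2 \<le> (1 - q\<^sup>2) * (x - (1 - \<beta>))\<^sup>2"
    using deviation by simp
  moreover have "q\<^sup>2 < 1"
    using q by (simp add: power_less_one_iff)
  ultimately have "\<bar>b - \<beta>\<bar> \<le> \<bar>x - (1 - \<beta>)\<bar>"
    by (simp add: abs_le_square_iff)
  moreover have "(1 - q) * x * x \<le> 1 * x"
    using q x by (intro mult_right_mono mult_le_one) auto
  then have "1 - \<beta> \<le> x"
    by (simp add: \<beta> power2_eq_square)
  moreover have "\<beta> \<le> 1"
    using q by (simp add: \<beta>)
  ultimately show ?thesis
    by linarith
qed

lemma abs_diff_one_le_of_sums:
  fixes b :: "'i \<Rightarrow> real" and q x :: real
  assumes I: "finite I" "card I = n" "k \<in> I"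
    and q: "0 \<le> q" "q < 1" "q\<^sup>2 = 1 - 1 / n" and x: "0 \<le> x" "x \<le> 1"
    and sum_b: "(\<Sum>i\<in>I. b i) = n * (1 - (1 - q) * x\<^sup>2)" and sum_b_sq: "(\<Sum>i\<in>I. (b i)\<^sup>2) = n"
  shows "\<bar>b k - 1\<bar> \<le> x"
proof (rule abs_diff_one_le_of_mean[OF q(1,2) x refl])
  define \<beta> where "\<beta> = 1 - (1 - q) * x\<^sup>2"
  have n: "real n > 0"
    using I by (auto simp: card_gt_0_iff)
  have "n\<^sup>2 * (b k - \<beta>)\<^sup>2 \<le> n\<^sup>2 * ((real n - 1) * (1 - \<beta>\<^sup>2))"
    using Samuelson_inequality[OF I(1,3), of b] I sum_b sum_b_sq
    by (simp add: \<beta>_def power2_eq_square algebra_simps)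
  then have "(b k - \<beta>)\<^sup>2 / n \<le> (real n - 1) * (1 - \<beta>\<^sup>2) / n"
    using n by (intro divide_right_mono) auto
  then have "(1 - q\<^sup>2) * (b k - \<beta>)\<^sup>2 \<le> q\<^sup>2 * (1 - \<beta>\<^sup>2)"
    unfolding q(3) using n by (simp add: diff_divide_distrib left_diff_distrib)
  then show "(1 - q\<^sup>2) * (b k - (1 - (1 - q) * x\<^sup>2))\<^sup>2 \<le> q\<^sup>2 * (1 - (1 - (1 - q) * x\<^sup>2)\<^sup>2)"
    by (simp only: \<beta>_def)
qed

lemma one_minus_square_power_le_prod:
  fixes b :: "'i \<Rightarrow> real" and q x :: real
  assumes I: "finite I" "card I = n" "n \<ge> 3"
    and q: "0 \<le> q" "q\<^sup>2 = 1 - 1 / n" and x: "0 \<le> x" "x < 1"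
    and sum_b: "(\<Sum>i\<in>I. b i) = n * (1 - (1 - q) * x\<^sup>2)" and sum_b_sq: "(\<Sum>i\<in>I. (b i)\<^sup>2) = n"
  shows "(1 - x\<^sup>2) ^ (n - 1) \<le> (\<Prod>i\<in>I. b i)"
proof -
  define c where "c = (- ln (1 - x) - x) / x\<^sup>2"
  have n: "real n \<ge> 3" and x_sq: "x\<^sup>2 < 1"
    using I x by (auto simp: power_less_one_iff)
  have "q\<^sup>2 < 1\<^sup>2" "(1 / 2)\<^sup>2 \<le> q\<^sup>2"
    using n unfolding q(2) by (simp_all add: field_simps)
  then have q_bounds: "q < 1" "1 / 2 \<le> q"
    using q(1) by (auto intro: power2_less_imp_less power2_le_imp_le)
  have nq: "n * (1 - q) = 1 / (1 + q)"
    using q n by (simp add: field_simps power2_eq_square)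
  have near_one: "\<bar>b i - 1\<bar> \<le> x" if "i \<in> I" for i
    by (rule abs_diff_one_le_of_sums[OF I(1,2) that _ _ _ _ _ sum_b sum_b_sq]) (use q q_bounds x in auto)
  have "(\<Sum>i\<in>I. b i - 1) = - (n * (1 - q)) * x\<^sup>2"
    using I sum_b by (simp add: sum_subtractf algebra_simps)
  then have dev: "(\<Sum>i\<in>I. b i - 1) = - (x\<^sup>2 / (1 + q))"
    by (simp add: nq)
  have "(\<Sum>i\<in>I. (b i - 1)\<^sup>2) = - (2 * (\<Sum>i\<in>I. b i - 1))"
    using I sum_b_sq by (simp add: power2_diff sum.distrib sum_subtractf flip: sum_distrib_left)
  then have dev_sq: "(\<Sum>i\<in>I. (b i - 1)\<^sup>2) = 2 * x\<^sup>2 / (1 + q)"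
    by (simp add: dev)
  have "2 * (3 / 2) \<le> (real n - 1) * (1 + q)"
    using n q_bounds by (intro mult_mono) auto
  then have "(real n - 1) * (1 + q) * ln (1 - x\<^sup>2) \<le> - (x\<^sup>2 + c * (2 * x\<^sup>2))"
    using mult_ln_one_minus_square_le[of "(real n - 1) * (1 + q)" x] x by (auto simp: c_def)
  then have "(real n - 1) * ln (1 - x\<^sup>2) \<le> - (x\<^sup>2 + c * (2 * x\<^sup>2)) / (1 + q)"
    using q by (simp add: pos_le_divide_eq mult_ac)
  also have "\<dots> = (\<Sum>i\<in>I. b i - 1) - c * (\<Sum>i\<in>I. (b i - 1)\<^sup>2)"
    unfolding dev dev_sq by (simp add: diff_divide_distrib)
  also have "\<dots> \<le> ln (\<Prod>i\<in>I. b i)"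
    unfolding c_def using I near_one x by (intro ln_prod_ge_quadratic)
  finally have "ln ((1 - x\<^sup>2) ^ (n - 1)) \<le> ln (\<Prod>i\<in>I. b i)"
    using x_sq n by (simp add: ln_realpow of_nat_diff)
  moreover have "0 < (\<Prod>i\<in>I. b i)"
    using near_one x by (intro prod_pos) fastforce
  ultimately show ?thesis
    using x_sq by simp
qed

lemma sum_le_sqrt_card:
  fixes f :: "'i \<Rightarrow> real"
  assumes "(\<Sum>i\<in>A. (f i)\<^sup>2) \<le> 1"
  shows "(\<Sum>i\<in>A. f i) \<le> sqrt (card A)"
proof -
  have "(\<Sum>i\<in>A. f i)\<^sup>2 \<le> (\<Sum>i\<in>A. (f i)\<^sup>2) * card A"
    by (rule sum_squared_le_sum_of_squares)
  also have "\<dots> \<le> card A"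
    using assms by (simp add: mult_left_le_one_le sum_nonneg)
  finally show ?thesis
    by (rule real_le_rsqrt)
qed

lemma sum_ratio_power_le_prod:
  fixes a :: "'i \<Rightarrow> real"
  assumes I: "finite I" "card I = n" "n \<ge> 3"
    and unit: "(\<Sum>i\<in>I. (a i)\<^sup>2) = 1" and sum: "sqrt (real n - 1) < (\<Sum>i\<in>I. a i)"
  shows "(((\<Sum>i\<in>I. a i) - sqrt (real n - 1)) / (sqrt n - sqrt (real n - 1))) ^ (n - 1)
    \<le> sqrt n ^ n * (\<Prod>i\<in>I. a i)"
proof -
  define \<sigma> m s where "\<sigma> = (\<Sum>i\<in>I. a i)" and "m = sqrt (real n - 1)" and "s = sqrt n"
  define x where "x = sqrt ((s - \<sigma>) / (s - m))"
  have s: "0 < s" "s * s = n" and m: "0 \<le> m" "m < s" "m\<^sup>2 = real n - 1"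
    using I by (auto simp: s_def m_def)
  have \<sigma>: "m < \<sigma>" "\<sigma> \<le> s"
    using sum sum_le_sqrt_card[of a I] unit I by (auto simp: \<sigma>_def m_def s_def)
  have x: "0 \<le> x" "x < 1" "x\<^sup>2 = (s - \<sigma>) / (s - m)"
    using \<sigma> m by (auto simp: x_def)
  have "(1 - x\<^sup>2) ^ (n - 1) \<le> (\<Prod>i\<in>I. s * a i)"
  proof (rule one_minus_square_power_le_prod[OF I, where q = "m / s"])
    show "(m / s)\<^sup>2 = 1 - 1 / n"
      using I s m by (simp add: power_divide power2_eq_square diff_divide_distrib)
    have "(1 - m / s) * x\<^sup>2 = (s - \<sigma>) / s"
      using s(1) m(2) unfolding x(3) by (simp add: field_simps)
    then have "n * ((1 - m / s) * x\<^sup>2) = s * (s - \<sigma>)"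
      using s(1) by (simp flip: s(2))
    then show "(\<Sum>i\<in>I. s * a i) = n * (1 - (1 - m / s) * x\<^sup>2)"
      by (simp add: \<sigma>_def right_diff_distrib s(2) flip: sum_distrib_left)
    show "(\<Sum>i\<in>I. (s * a i)\<^sup>2) = n"
      using unit by (simp add: s_def power_mult_distrib flip: sum_distrib_left)
  qed (use m s x in auto)
  also have "1 - x\<^sup>2 = (\<sigma> - m) / (s - m)"
    using m by (simp add: x(3) field_simps)
  also have "(\<Prod>i\<in>I. s * a i) = s ^ n * (\<Prod>i\<in>I. a i)"
    using I by (simp add: prod.distrib)
  finally show ?thesis
    by (simp add: \<sigma>_def m_def s_def)
qed

lemma corner_depth_power_le_prod:
  fixes a :: "'i \<Rightarrow> real"
  assumes I: "finite I" "card I = n" "n \<ge> 3"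
    and unit: "(\<Sum>i\<in>I. (a i)\<^sup>2) = 1"
    and t: "sqrt (real n - 1) / 2 < t" "t \<le> (\<Sum>i\<in>I. a i) / 2"
  shows "((\<Sum>i\<in>I. a i) / 2 - t) ^ (n - 1) \<le> sqrt n ^ n * (\<Prod>i\<in>I. a i) * (sqrt n / 2 - t) ^ (n - 1)"
proof -
  define \<sigma> m s where "\<sigma> = (\<Sum>i\<in>I. a i)" and "m = sqrt (real n - 1)" and "s = sqrt n"
  have \<sigma>: "\<sigma> \<le> s" and m: "m < s" and t': "m < 2 * t" "2 * t \<le> \<sigma>"
    using sum_le_sqrt_card[of a I] unit I t by (auto simp: \<sigma>_def m_def s_def)
  have "(s - \<sigma>) * m \<le> (s - \<sigma>) * (2 * t)"
    using \<sigma> t' by (intro mult_left_mono) auto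
  then have "\<sigma> / 2 - t \<le> (\<sigma> - m) / (s - m) * (s / 2 - t)"
    using m by (simp add: field_simps)
  then have "(\<sigma> / 2 - t) ^ (n - 1) \<le> ((\<sigma> - m) / (s - m) * (s / 2 - t)) ^ (n - 1)"
    using t' by (intro power_mono) auto
  also have "\<dots> \<le> s ^ n * (\<Prod>i\<in>I. a i) * (s / 2 - t) ^ (n - 1)"
    unfolding power_mult_distrib
    using sum_ratio_power_le_prod[OF I unit] \<sigma> t'
    by (intro mult_right_mono) (auto simp: \<sigma>_def m_def s_def)
  finally show ?thesis
    by (simp add: \<sigma>_def s_def)
qed

section \<open>The area of a corner section\<close>

lemma PiM_lborel_affine:
  fixes c d :: "'i \<Rightarrow> real"
  assumes "finite A" and d: "\<And>i. i \<in> A \<Longrightarrow> d i \<noteq> 0"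
  defines "M \<equiv> Pi\<^sub>M A (\<lambda>_. lborel)"
  shows "M = density (distr M M (\<lambda>x. \<lambda>i\<in>A. c i + d i * x i)) (\<lambda>_. \<Prod>i\<in>A. \<bar>d i\<bar>)"
proof -
  interpret product_sigma_finite "\<lambda>_ :: 'i. lborel :: real measure"
    by standard
  let ?T = "\<lambda>x. \<lambda>i\<in>A. c i + d i * x i"
  have [measurable]: "?T \<in> M \<rightarrow>\<^sub>M M"
    unfolding M_def by measurable
  have lborel: "emeasure lborel S = \<bar>d i\<bar> * emeasure lborel ((\<lambda>y. c i + d i * y) -` S)"
    if "i \<in> A" "S \<in> sets borel" for i S
    by (subst lborel_real_affine[OF d[OF \<open>i \<in> A\<close>], of "c i"])
      (use that in \<open>simp add: emeasure_density emeasure_distr nn_integral_cmult\<close>)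
  have "density (distr M M ?T) (\<lambda>_. \<Prod>i\<in>A. \<bar>d i\<bar>) = Pi\<^sub>M A (\<lambda>_. lborel)"
  proof (rule PiM_eqI)
    fix S :: "'i \<Rightarrow> real set" assume S: "\<And>i. i \<in> A \<Longrightarrow> S i \<in> sets lborel"
    then have "Pi\<^sub>E A S \<in> sets M"
      unfolding M_def using \<open>finite A\<close> by (intro sets_PiM_I_finite) auto
    then have "emeasure (density (distr M M ?T) (\<lambda>_. \<Prod>i\<in>A. \<bar>d i\<bar>)) (Pi\<^sub>E A S)
        = (\<Prod>i\<in>A. ennreal \<bar>d i\<bar>) * emeasure M (?T -` Pi\<^sub>E A S \<inter> space M)"
      by (simp add: emeasure_density emeasure_distr nn_integral_cmult prod_ennreal)
    also have "?T -` Pi\<^sub>E A S \<inter> space M = (\<Pi>\<^sub>E i\<in>A. (\<lambda>y. c i + d i * y) -` S i)"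
      by (auto simp: M_def space_PiM)
    also have "emeasure M \<dots> = (\<Prod>i\<in>A. emeasure lborel ((\<lambda>y. c i + d i * y) -` S i))"
      unfolding M_def using S \<open>finite A\<close>
      by (intro emeasure_PiM) (auto intro!: measurable_sets_borel[where M = borel])
    also have "(\<Prod>i\<in>A. ennreal \<bar>d i\<bar>) * \<dots> = (\<Prod>i\<in>A. emeasure lborel (S i))"
      using S by (simp add: lborel flip: prod.distrib)
    finally show "emeasure (density (distr M M ?T) (\<lambda>_. \<Prod>i\<in>A. \<bar>d i\<bar>)) (Pi\<^sub>E A S)
        = (\<Prod>i\<in>A. emeasure lborel (S i))" .
  qed (use \<open>finite A\<close> in \<open>auto simp: M_def\<close>)
  then show ?thesis
    by (simp add: M_def)
qed

lemma emeasure_PiM_lborel_affine: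
  fixes c d :: "'i \<Rightarrow> real"
  assumes "finite A" and d: "\<And>i. i \<in> A \<Longrightarrow> d i \<noteq> 0"
  defines "M \<equiv> Pi\<^sub>M A (\<lambda>_. lborel)"
  assumes S: "S \<in> sets M"
  shows "emeasure M S = (\<Prod>i\<in>A. \<bar>d i\<bar>) * emeasure M {x \<in> space M. (\<lambda>i\<in>A. c i + d i * x i) \<in> S}"
proof -
  define T where "T x = (\<lambda>i\<in>A. c i + d i * x i)" for x
  have [measurable]: "T \<in> M \<rightarrow>\<^sub>M M"
    unfolding M_def T_def by measurable
  have "M = density (distr M M T) (\<lambda>_. \<Prod>i\<in>A. \<bar>d i\<bar>)"
    unfolding M_def T_def using \<open>finite A\<close> d by (rule PiM_lborel_affine)
  then have "emeasure M S = emeasure (density (distr M M T) (\<lambda>_. \<Prod>i\<in>A. \<bar>d i\<bar>)) S"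
    by (rule arg_cong)
  also have "\<dots> = (\<Prod>i\<in>A. \<bar>d i\<bar>) * emeasure M (T -` S \<inter> space M)"
    using S by (simp add: emeasure_density emeasure_distr nn_integral_cmult)
  also have "T -` S \<inter> space M = {x \<in> space M. T x \<in> S}"
    by blast
  finally show ?thesis
    by (simp only: T_def)
qed

definition corner_simplex :: "'i set \<Rightarrow> ('i \<Rightarrow> real) \<Rightarrow> ('i \<Rightarrow> real) \<Rightarrow> real \<Rightarrow> ('i \<Rightarrow> real) set" where
  "corner_simplex A a c h =
    {x \<in> space (Pi\<^sub>M A (\<lambda>_. lborel)). (\<forall>i\<in>A. x i \<le> c i) \<and> (\<Sum>i\<in>A. a i * (c i - x i)) \<le> h}"

lemma emeasure_corner_simplex:
  fixes a c :: "'i \<Rightarrow> real"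
  assumes "finite A" and pos: "\<And>i. i \<in> A \<Longrightarrow> 0 < a i" and "0 \<le> h"
  shows "emeasure (Pi\<^sub>M A (\<lambda>_. lborel)) (corner_simplex A a c h)
    = ennreal (h ^ card A / (fact (card A) * (\<Prod>i\<in>A. a i)))"
proof -
  define M where "M = Pi\<^sub>M A (\<lambda>_. lborel :: real measure)"
  define S where "S = corner_simplex A a c h"
  have S_eq: "S = {x \<in> space M. (\<forall>i\<in>A. x i \<le> c i) \<and> (\<Sum>i\<in>A. a i * (c i - x i)) \<le> h}"
    by (simp add: S_def M_def corner_simplex_def)
  define T where "T x = (\<lambda>i\<in>A. c i + (- 1 / a i) * x i)" for x
  let ?\<Delta> = "{x. (\<forall>i\<in>A. 0 \<le> x i) \<and> sum x A \<le> h} \<inter> space M"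
  have T: "T x \<in> S \<longleftrightarrow> x \<in> ?\<Delta>" if "x \<in> space M" for x
  proof -
    have "T x i \<le> c i \<longleftrightarrow> 0 \<le> x i" "a i * (c i - T x i) = x i" if "i \<in> A" for i
      using pos[OF that] that by (simp_all add: T_def zero_le_divide_iff)
    moreover have "T x \<in> space M"
      by (simp add: M_def T_def space_PiM PiE_def)
    ultimately show ?thesis
      using that by (simp add: S_eq)
  qed
  have "S \<in> sets M"
    unfolding S_eq M_def using \<open>finite A\<close> by measurable
  then have "emeasure M S = (\<Prod>i\<in>A. \<bar>- 1 / a i\<bar>) * emeasure M {x \<in> space M. T x \<in> S}"
    unfolding M_def T_def using \<open>finite A\<close> pos by (intro emeasure_PiM_lborel_affine) force+
  also have "{x \<in> space M. T x \<in> S} = ?\<Delta>"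
    using T by blast
  also have "emeasure M ?\<Delta> = h ^ card A / fact (card A)"
    unfolding M_def using \<open>finite A\<close> \<open>0 \<le> h\<close> by (rule emeasure_std_simplex_aux)
  also have "(\<Prod>i\<in>A. \<bar>- 1 / a i\<bar>) = 1 / (\<Prod>i\<in>A. a i)"
    using pos by (simp add: less_imp_le prod_dividef cong: prod.cong)
  also have "ennreal (1 / (\<Prod>i\<in>A. a i)) * ennreal (h ^ card A / fact (card A))
      = ennreal (h ^ card A / (fact (card A) * (\<Prod>i\<in>A. a i)))"
    using pos \<open>0 \<le> h\<close> by (simp add: prod_nonneg less_imp_le mult.commute flip: ennreal_mult)
  finally show ?thesis
    by (simp only: S_def M_def)
qed

lemma emeasure_PiM_insert_shear:
  fixes f :: "('i \<Rightarrow> real) \<Rightarrow> real" and c :: real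
  assumes A: "finite A" "k \<notin> A" and X: "X \<in> sets (Pi\<^sub>M (insert k A) (\<lambda>_. lborel))"
    and f: "f \<in> borel_measurable (Pi\<^sub>M A (\<lambda>_. lborel))" and "c \<noteq> 0"
  shows "emeasure (Pi\<^sub>M (insert k A) (\<lambda>_. lborel)) X
    = \<bar>c\<bar> * (\<integral>\<^sup>+ h. emeasure (Pi\<^sub>M A (\<lambda>_. lborel))
        {x \<in> space (Pi\<^sub>M A (\<lambda>_. lborel)). x(k := f x + c * h) \<in> X} \<partial>lborel)"
proof -
  interpret product_sigma_finite "\<lambda>_ :: 'i. lborel :: real measure"
    by standard
  interpret M: finite_product_sigma_finite "\<lambda>_ :: 'i. lborel :: real measure" A
    by standard (rule A)
  let ?M = "\<lambda>A :: 'i set. Pi\<^sub>M A (\<lambda>_. lborel :: real measure)"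
  interpret pair_sigma_finite "?M A" lborel
    by (intro pair_sigma_finite.intro M.sigma_finite_measure_axioms lborel.sigma_finite_measure_axioms)
  note X [measurable] f [measurable]
  have [measurable]:
    "(\<lambda>(x, y). indicator X (x(k := f x + c * y)) :: ennreal) \<in> borel_measurable (?M A \<Otimes>\<^sub>M lborel)"
    by measurable
  have slice: "(\<integral>\<^sup>+ x. indicator X (x(k := f x + c * h)) \<partial>?M A)
      = emeasure (?M A) {x \<in> space (?M A). x(k := f x + c * h) \<in> X}" for h
  proof -
    have "{x \<in> space (?M A). x(k := f x + c * h) \<in> X} \<in> sets (?M A)"
      by measurable
    then show ?thesis
      by (subst nn_integral_indicator[symmetric], simp) (rule nn_integral_cong, simp add: indicator_def)
  qed
  have "emeasure (?M (insert k A)) X = (\<integral>\<^sup>+ x. \<integral>\<^sup>+ y. indicator X (x(k := y)) \<partial>lborel \<partial>?M A)"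
    using A X by (simp flip: product_nn_integral_insert)
  also have "\<dots> = (\<integral>\<^sup>+ x. \<bar>c\<bar> * (\<integral>\<^sup>+ h. indicator X (x(k := f x + c * h)) \<partial>lborel) \<partial>?M A)"
    using \<open>c \<noteq> 0\<close> by (intro nn_integral_cong nn_integral_real_affine) measurable
  also have "\<dots> = \<bar>c\<bar> * (\<integral>\<^sup>+ x. \<integral>\<^sup>+ h. indicator X (x(k := f x + c * h)) \<partial>lborel \<partial>?M A)"
    by (intro nn_integral_cmult) measurable
  also have "\<dots> = \<bar>c\<bar> * (\<integral>\<^sup>+ h. \<integral>\<^sup>+ x. indicator X (x(k := f x + c * h)) \<partial>?M A \<partial>lborel)"
    by (subst Fubini') simp_all
  finally show ?thesis
    by (simp only: slice)
qed

lemma corner_coordinate_le_iff: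
  fixes a c z :: "'i \<Rightarrow> real"
  assumes A: "finite A" "k \<notin> A" and "0 < a k" and unit: "(\<Sum>i\<in>insert k A. (a i)\<^sup>2) = 1"
    and z: "(\<Sum>i\<in>insert k A. a i * z i) = t + h"
  shows "z k \<le> c k + h * a k
    \<longleftrightarrow> (\<Sum>i\<in>A. a i * (c i + h * a i - z i)) \<le> (\<Sum>i\<in>insert k A. a i * c i) - t"
proof -
  have "(\<Sum>i\<in>A. a i * (c i + h * a i - z i))
      = (\<Sum>i\<in>insert k A. a i * (c i + h * a i - z i)) - a k * (c k + h * a k - z k)"
    using A by simp
  also have "(\<Sum>i\<in>insert k A. a i * (c i + h * a i - z i))
      = (\<Sum>i\<in>insert k A. a i * c i) + h * (\<Sum>i\<in>insert k A. (a i)\<^sup>2) - (\<Sum>i\<in>insert k A. a i * z i)"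
    by (simp only: sum.distrib sum_subtractf sum_distrib_left ring_distribs power2_eq_square mult_ac)
  finally have "(\<Sum>i\<in>A. a i * (c i + h * a i - z i))
      = (\<Sum>i\<in>insert k A. a i * c i) - t - a k * (c k + h * a k - z k)"
    by (simp only: unit z)
  then show ?thesis
    using \<open>0 < a k\<close> by (simp add: zero_le_mult_iff)
qed

text \<open>
  For a unit vector \<open>a\<close> this is, in coordinates, the right cylinder of height 1 in direction \<open>a\<close> over the
  section \<open>{x. a \<bullet> x = t \<and> x \<le> c}\<close>.
\<close>
definition corner_cylinder :: "'i set \<Rightarrow> ('i \<Rightarrow> real) \<Rightarrow> ('i \<Rightarrow> real) \<Rightarrow> real \<Rightarrow> ('i \<Rightarrow> real) set" where
  "corner_cylinder A a c t = {x \<in> space (Pi\<^sub>M A (\<lambda>_. lborel)).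
    (\<Sum>i\<in>A. a i * x i) - t \<in> {0..1} \<and> (\<forall>i\<in>A. x i - ((\<Sum>i\<in>A. a i * x i) - t) * a i \<le> c i)}"

lemma sets_corner_cylinder:
  assumes "finite A"
  shows "corner_cylinder A a c t \<in> sets (Pi\<^sub>M A (\<lambda>_. lborel))"
  unfolding corner_cylinder_def using assms by measurable

text \<open>
  Shearing along one coordinate \<open>k\<close> so that it becomes \<open>h = a \<bullet> x - t\<close> turns the slices at constant
  height into translates of one simplex in the remaining coordinates.
\<close>
lemma corner_cylinder_slice_iff:
  fixes a c x :: "'i \<Rightarrow> real" and t h :: real
  assumes A: "finite A" "k \<notin> A" and "0 < a k" and unit: "(\<Sum>i\<in>insert k A. (a i)\<^sup>2) = 1"
    and x: "x \<in> space (Pi\<^sub>M A (\<lambda>_. lborel))"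
  shows "x(k := (t - (\<Sum>i\<in>A. a i * x i)) / a k + 1 / a k * h) \<in> corner_cylinder (insert k A) a c t
    \<longleftrightarrow> h \<in> {0..1} \<and> x \<in> corner_simplex A a (\<lambda>i. c i + h * a i) ((\<Sum>i\<in>insert k A. a i * c i) - t)"
proof -
  define z where "z = x(k := (t - (\<Sum>i\<in>A. a i * x i)) / a k + 1 / a k * h)"
  have z: "z k = (t - (\<Sum>i\<in>A. a i * x i)) / a k + 1 / a k * h" "\<And>i. i \<in> A \<Longrightarrow> z i = x i"
      "z \<in> space (Pi\<^sub>M (insert k A) (\<lambda>_. lborel))"
    using x A by (auto simp: z_def space_PiM PiE_def extensional_def)
  have "(\<Sum>i\<in>A. a i * z i) = (\<Sum>i\<in>A. a i * x i)"
    by (intro sum.cong) (auto simp: z)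
  then have height: "(\<Sum>i\<in>insert k A. a i * z i) = t + h"
    using A \<open>0 < a k\<close> by (simp add: z field_simps)
  have "(\<Sum>i\<in>A. a i * (c i + h * a i - x i)) = (\<Sum>i\<in>A. a i * (c i + h * a i - z i))"
    by (intro sum.cong) (auto simp: z)
  then have "(\<Sum>i\<in>A. a i * (c i + h * a i - x i)) \<le> (\<Sum>i\<in>insert k A. a i * c i) - t \<longleftrightarrow> z k \<le> c k + h * a k"
    by (simp only: corner_coordinate_le_iff[OF A \<open>0 < a k\<close> unit height])
  moreover have "z \<in> corner_cylinder (insert k A) a c t
      \<longleftrightarrow> h \<in> {0..1} \<and> z k \<le> c k + h * a k \<and> (\<forall>i\<in>A. x i \<le> c i + h * a i)"
    unfolding corner_cylinder_def mem_Collect_eq height using z by (auto simp: algebra_simps)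
  ultimately show ?thesis
    unfolding z_def corner_simplex_def mem_Collect_eq using x by blast
qed

lemma emeasure_corner_cylinder:
  fixes a c :: "'i \<Rightarrow> real" and t :: real
  assumes B: "finite B" "B \<noteq> {}" and pos: "\<And>i. i \<in> B \<Longrightarrow> 0 < a i" and unit: "(\<Sum>i\<in>B. (a i)\<^sup>2) = 1"
    and depth: "t \<le> (\<Sum>i\<in>B. a i * c i)"
  shows "emeasure (Pi\<^sub>M B (\<lambda>_. lborel)) (corner_cylinder B a c t)
    = ennreal (((\<Sum>i\<in>B. a i * c i) - t) ^ (card B - 1) / (fact (card B - 1) * (\<Prod>i\<in>B. a i)))"
proof -
  obtain k where "k \<in> B"
    using B by auto
  then obtain A where A: "B = insert k A" "k \<notin> A" "finite A"
    using B by (metis finite_insert mk_disjoint_insert)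
  let ?M = "\<lambda>A :: 'i set. Pi\<^sub>M A (\<lambda>_. lborel :: real measure)"
  define X where "X = corner_cylinder B a c t"
  define f where "f x = (t - (\<Sum>i\<in>A. a i * x i)) / a k" for x
  define s where "s = (\<Sum>i\<in>B. a i * c i) - t"
  define \<Delta> where "\<Delta> h = corner_simplex A a (\<lambda>i. c i + h * a i) s" for h
  define K where "K = s ^ card A / (fact (card A) * (\<Prod>i\<in>A. a i))"
  have "0 < a k" "0 \<le> s"
    using pos depth A by (auto simp: s_def)
  have "0 \<le> K"
    unfolding K_def using pos \<open>0 \<le> s\<close> A
    by (auto intro!: divide_nonneg_nonneg mult_nonneg_nonneg prod_nonneg simp: less_imp_le)
  have [measurable]: "f \<in> borel_measurable (?M A)"
    unfolding f_def by measurable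
  have X: "X \<in> sets (?M (insert k A))"
    using B(1) unfolding X_def A(1) by (rule sets_corner_cylinder)
  have slice: "emeasure (?M A) {x \<in> space (?M A). x(k := f x + 1 / a k * h) \<in> X}
      = ennreal K * indicator {0..1} h" for h
  proof -
    have "{x \<in> space (?M A). x(k := f x + 1 / a k * h) \<in> X} = (if h \<in> {0..1} then \<Delta> h else {})"
      using corner_cylinder_slice_iff[of A k a _ t h c] A \<open>0 < a k\<close> unit
      by (auto simp: X_def f_def s_def \<Delta>_def corner_simplex_def)
    moreover have "emeasure (?M A) (\<Delta> h) = K"
      unfolding \<Delta>_def K_def using A pos \<open>0 \<le> s\<close> by (intro emeasure_corner_simplex) auto
    ultimately show ?thesis
      by (simp only: if_distrib[of "emeasure (?M A)"]) (simp add: indicator_def)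
  qed
  have "emeasure (?M B) X
      = \<bar>1 / a k\<bar> * (\<integral>\<^sup>+ h. emeasure (?M A) {x \<in> space (?M A). x(k := f x + 1 / a k * h) \<in> X} \<partial>lborel)"
    unfolding A(1) using A X \<open>0 < a k\<close> by (intro emeasure_PiM_insert_shear) auto
  also have "\<dots> = ennreal (1 / a k * K)"
    unfolding slice using \<open>0 < a k\<close> \<open>0 \<le> K\<close> by (simp add: nn_integral_cmult flip: ennreal_mult)
  also have "1 / a k * K = s ^ (card B - 1) / (fact (card B - 1) * (\<Prod>i\<in>B. a i))"
    using A by (simp add: K_def)
  finally show ?thesis
    by (simp only: X_def s_def)
qed

definition corner_area :: "'a::euclidean_space \<Rightarrow> real \<Rightarrow> real" where
  "corner_area a h = h ^ (DIM('a) - 1) / (fact (DIM('a) - 1) * (\<Prod>b\<in>Basis. a \<bullet> b))"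

definition cylinder :: "'a::euclidean_space \<Rightarrow> 'a set \<Rightarrow> 'a set" where
  "cylinder a S = {x + s *\<^sub>R a | x s. x \<in> S \<and> s \<in> {0..1}}"

lemma hvol_eq_measure_cylinder: "hvol a S = measure lebesgue (cylinder a S)"
  by (simp add: hvol_def cylinder_def)

lemma cylinder_hyperplane_Int:
  assumes "norm a = 1"
  shows "cylinder a (hyperplane a t \<inter> S) = {p. a \<bullet> p - t \<in> {0..1} \<and> p - (a \<bullet> p - t) *\<^sub>R a \<in> S}"
    (is "?L = ?R")
proof (intro equalityI subsetI)
  have "a \<bullet> a = 1"
    using assms by (simp add: norm_eq_1)
  then show "p \<in> ?R" if "p \<in> ?L" for p
    using that by (auto simp: cylinder_def hyperplane_def inner_add_right)
  fix p assume "p \<in> ?R"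
  then have "p - (a \<bullet> p - t) *\<^sub>R a \<in> hyperplane a t \<inter> S" "a \<bullet> p - t \<in> {0..1}"
    using \<open>a \<bullet> a = 1\<close> by (auto simp: hyperplane_def inner_diff_right)
  then have "(p - (a \<bullet> p - t) *\<^sub>R a) + (a \<bullet> p - t) *\<^sub>R a \<in> ?L"
    unfolding cylinder_def by blast
  then show "p \<in> ?L"
    by simp
qed

lemma sum_Basis_square_eq_1:
  fixes a :: "'a::euclidean_space"
  assumes "norm a = 1"
  shows "(\<Sum>b\<in>Basis. (a \<bullet> b)\<^sup>2) = 1"
  using assms by (simp add: norm_eq_1 power2_eq_square flip: euclidean_inner)

lemma hvol_hyperplane_Int_atMost:
  fixes a c :: "'a::ordered_euclidean_space"
  assumes pos: "\<And>b. b \<in> Basis \<Longrightarrow> 0 < a \<bullet> b" and "norm a = 1" and "t \<le> a \<bullet> c"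
  shows "hvol a (hyperplane a t \<inter> {..c}) = corner_area a (a \<bullet> c - t)"
proof -
  let ?M = "Pi\<^sub>M (Basis :: 'a set) (\<lambda>_. lborel :: real measure)"
  let ?C = "cylinder a (hyperplane a t \<inter> {..c})"
  have C: "?C = {p. a \<bullet> p - t \<in> {0..1} \<and> (\<forall>b\<in>Basis. p \<bullet> b - (a \<bullet> p - t) * (a \<bullet> b) \<le> c \<bullet> b)}"
    using \<open>norm a = 1\<close> by (simp add: cylinder_hyperplane_Int eucl_le[where 'a = 'a] inner_diff_left)
  have [measurable]: "?C \<in> sets borel"
    unfolding C Ball_def atLeastAtMost_iff
    by (intro borel_closed closed_Collect_conj closed_Collect_all closed_Collect_imp closed_Collect_le
        continuous_intros open_Collect_const)
  have "emeasure lborel ?C = emeasure ?M ((\<lambda>x. \<Sum>b\<in>Basis. x b *\<^sub>R b) -` ?C \<inter> space ?M)"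
    by (subst lborel_eq) (simp add: emeasure_distr)
  also have "(\<lambda>x. \<Sum>b\<in>Basis. x b *\<^sub>R b) -` ?C \<inter> space ?M = corner_cylinder Basis (\<lambda>b. a \<bullet> b) (\<lambda>b. c \<bullet> b) t"
    by (auto simp: C corner_cylinder_def inner_sum_right mult.commute)
  also have "emeasure ?M \<dots> = corner_area a (a \<bullet> c - t)"
    unfolding corner_area_def euclidean_inner[of a c]
    using pos \<open>t \<le> a \<bullet> c\<close> sum_Basis_square_eq_1[OF \<open>norm a = 1\<close>]
    by (intro emeasure_corner_cylinder) (auto simp: euclidean_inner[of a c])
  finally show ?thesis
    using pos \<open>t \<le> a \<bullet> c\<close>
    by (simp add: hvol_eq_measure_cylinder measure_completion measure_def corner_area_def
        prod_nonneg less_imp_le)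
qed

section \<open>Reflections in coordinate hyperplanes\<close>

definition reflect_coords :: "'a set \<Rightarrow> 'a::euclidean_space \<Rightarrow> 'a" where
  "reflect_coords N x = (\<Sum>b\<in>Basis. ((if b \<in> N then - 1 else 1) * (x \<bullet> b)) *\<^sub>R b)"

lemma reflect_coords_inner_Basis [simp]:
  "b \<in> Basis \<Longrightarrow> reflect_coords N x \<bullet> b = (if b \<in> N then - 1 else 1) * (x \<bullet> b)"
  by (simp add: reflect_coords_def)

lemma reflect_coords_involution [simp]: "reflect_coords N (reflect_coords N x) = x"
  by (rule euclidean_eqI) simp

lemma reflect_coords_add_scaleR:
  "reflect_coords N (x + s *\<^sub>R y) = reflect_coords N x + s *\<^sub>R reflect_coords N y"
  by (rule euclidean_eqI) (simp add: inner_add_left)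

lemma inner_reflect_coords: "reflect_coords N x \<bullet> y = x \<bullet> reflect_coords N y"
  unfolding euclidean_inner[of "reflect_coords N x" y] euclidean_inner[of x "reflect_coords N y"]
  by (intro sum.cong) auto

lemma reflect_coords_image_eq_vimage: "reflect_coords N ` S = reflect_coords N -` S"
  by (force simp: image_iff intro: rev_bexI)

lemma reflect_coords_image_cylinder:
  "reflect_coords N ` cylinder a S = cylinder (reflect_coords N a) (reflect_coords N ` S)"
  by (force simp: cylinder_def reflect_coords_add_scaleR image_iff)

lemma measure_lebesgue_reflect_coords: "measure lebesgue (reflect_coords N ` S) = measure lebesgue S"
proof -
  let ?R = "reflect_coords N"
  have R: "?R = (\<lambda>x. 0 + (\<Sum>b\<in>Basis. ((if b \<in> N then - 1 else 1) * (x \<bullet> b)) *\<^sub>R b))"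
    by (simp add: reflect_coords_def fun_eq_iff)
  have meas: "?R \<in> lebesgue \<rightarrow>\<^sub>M lebesgue"
    unfolding R by (rule lebesgue_affine_measurable) simp
  have "lebesgue = density (distr lebesgue lebesgue ?R) (\<lambda>_. \<Prod>b\<in>Basis. \<bar>if b \<in> N then - 1 else 1 :: real\<bar>)"
    unfolding R by (rule lebesgue_affine_euclidean) simp
  also have "(\<Prod>b\<in>Basis. \<bar>if b \<in> N then - 1 else 1 :: real\<bar>) = 1"
    by (intro prod.neutral) simp
  finally have lebesgue: "lebesgue = distr lebesgue lebesgue ?R"
    by (simp add: density_1)
  show ?thesis
  proof (cases "S \<in> sets lebesgue")
    case True
    then have "measure lebesgue S = measure lebesgue (?R -` S)"
      by (subst lebesgue) (simp add: measure_distr meas)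
    then show ?thesis
      by (simp add: reflect_coords_image_eq_vimage)
  next
    case False
    then have "?R ` S \<notin> sets lebesgue"
      using measurable_sets[OF meas, of "?R ` S"]
      by (auto simp: image_image simp flip: reflect_coords_image_eq_vimage)
    with False show ?thesis
      by (simp add: measure_notin_sets)
  qed
qed

lemma sec_area_reflect_coords:
  fixes a :: "'a::euclidean_space"
  shows "sec_area (reflect_coords N a) t = sec_area a t"
proof -
  have "reflect_coords N x \<in> cube \<longleftrightarrow> x \<in> cube" for x :: 'a
    by (auto simp: cube_def)
  then have "reflect_coords N ` (hyperplane a t \<inter> cube) = hyperplane (reflect_coords N a) t \<inter> cube"
    by (auto simp: reflect_coords_image_eq_vimage hyperplane_def inner_reflect_coords)
  then show ?thesis
    unfolding sec_area_def hvol_eq_measure_cylinder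
    by (metis reflect_coords_image_cylinder measure_lebesgue_reflect_coords)
qed

lemma sec_area_abs:
  fixes a :: "'a::ordered_euclidean_space"
  shows "sec_area \<bar>a\<bar> t = sec_area a t"
proof -
  have "\<bar>a\<bar> = reflect_coords {b. a \<bullet> b < 0} a"
    by (rule euclidean_eqI) (simp add: abs_inner)
  then show ?thesis
    by (simp add: sec_area_reflect_coords)
qed

section \<open>Sections close to a vertex of the cube\<close>

lemma inner_One: "(x :: 'a::euclidean_space) \<bullet> One = (\<Sum>b\<in>Basis. x \<bullet> b)"
  by (rule inner_sum_right)

lemma mem_cube_iff_abs_le: "x \<in> cube \<longleftrightarrow> \<bar>x :: 'a::ordered_euclidean_space\<bar> \<le> (1 / 2) *\<^sub>R One"
  by (simp add: cube_def eucl_le[where 'a = 'a] abs_inner)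

lemma inner_le_inner_abs:
  fixes a x :: "'a::ordered_euclidean_space"
  shows "a \<bullet> x \<le> \<bar>a\<bar> \<bullet> \<bar>x\<bar>"
  unfolding euclidean_inner[of a x] euclidean_inner[of "\<bar>a\<bar>" "\<bar>x\<bar>"]
  by (intro sum_mono) (simp add: abs_inner flip: abs_mult)

lemma sec_area_eq_0:
  fixes a :: "'a::ordered_euclidean_space"
  assumes "\<bar>a\<bar> \<bullet> One / 2 < t"
  shows "sec_area a t = 0"
proof -
  have "a \<bullet> x < t" if "x \<in> cube" for x
  proof -
    have "0 \<le> \<bar>a\<bar> \<bullet> ((1 / 2) *\<^sub>R One - \<bar>x\<bar>)"
      using that by (intro inner_nonneg_nonneg) (simp_all add: mem_cube_iff_abs_le)
    then show ?thesis
      using inner_le_inner_abs[of a x] assms by (simp add: inner_diff_right)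
  qed
  then have "hyperplane a t \<inter> cube = {}"
    by (fastforce simp: hyperplane_def)
  then show ?thesis
    by (simp add: sec_area_def hvol_def)
qed

lemma sum_Basis_minus_le:
  fixes a :: "'a::euclidean_space"
  assumes "norm a = 1" "k \<in> Basis"
  shows "(\<Sum>b\<in>Basis - {k}. a \<bullet> b) \<le> sqrt (real DIM('a) - 1)"
proof -
  have "(\<Sum>b\<in>Basis - {k}. (a \<bullet> b)\<^sup>2) \<le> 1"
    using assms sum_Basis_square_eq_1[of a] by (simp add: sum_diff1)
  then have "(\<Sum>b\<in>Basis - {k}. a \<bullet> b) \<le> sqrt (card (Basis - {k}))"
    by (rule sum_le_sqrt_card)
  then show ?thesis
    using assms DIM_positive[where 'a = 'a] by (simp add: of_nat_diff)
qed

lemma hyperplane_Int_cube_eq_corner: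
  fixes a :: "'a::ordered_euclidean_space"
  assumes pos: "\<And>b. b \<in> Basis \<Longrightarrow> 0 < a \<bullet> b" and "norm a = 1"
    and t: "sqrt (real DIM('a) - 1) / 2 \<le> t"
  shows "hyperplane a t \<inter> cube = hyperplane a t \<inter> {..(1 / 2) *\<^sub>R One}"
proof -
  have "x \<in> cube" if "a \<bullet> x = t" and x: "x \<le> (1 / 2) *\<^sub>R One" for x
  proof -
    have le_half: "x \<bullet> b \<le> 1 / 2" if "b \<in> Basis" for b
      using inner_Basis_mono[OF x that] that by simp
    have "0 \<le> x \<bullet> k" if "k \<in> Basis" for k
    proof -
      have "t = (a \<bullet> k) * (x \<bullet> k) + (\<Sum>b\<in>Basis - {k}. (a \<bullet> b) * (x \<bullet> b))"
        using \<open>a \<bullet> x = t\<close> that by (simp add: euclidean_inner[of a x] sum.remove)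
      also have "(\<Sum>b\<in>Basis - {k}. (a \<bullet> b) * (x \<bullet> b)) \<le> (\<Sum>b\<in>Basis - {k}. (a \<bullet> b) * (1 / 2))"
        using le_half pos by (intro sum_mono mult_left_mono) (auto simp: less_imp_le)
      also have "\<dots> = (\<Sum>b\<in>Basis - {k}. a \<bullet> b) / 2"
        by (simp add: sum_divide_distrib)
      also have "\<dots> \<le> t"
        using sum_Basis_minus_le[OF \<open>norm a = 1\<close> that] t by simp
      finally show ?thesis
        using pos[OF that] by (simp add: zero_le_mult_iff)
    qed
    then show ?thesis
      using le_half unfolding cube_def by (auto simp: abs_le_iff)
  qed
  moreover have "x \<le> (1 / 2) *\<^sub>R One" if "x \<in> cube" for x :: 'a
    using that abs_ge_self[of x] unfolding mem_cube_iff_abs_le by (rule order_trans[rotated])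
  ultimately show ?thesis
    by (auto simp: hyperplane_def)
qed

lemma sec_area_corner:
  fixes a :: "'a::ordered_euclidean_space"
  assumes pos: "\<And>b. b \<in> Basis \<Longrightarrow> 0 < a \<bullet> b" and "norm a = 1"
    and t: "sqrt (real DIM('a) - 1) / 2 \<le> t" "t \<le> a \<bullet> One / 2"
  shows "sec_area a t = corner_area a (a \<bullet> One / 2 - t)"
  using hvol_hyperplane_Int_atMost[of a t "(1 / 2) *\<^sub>R One"] hyperplane_Int_cube_eq_corner[of a t] assms
  by (simp add: sec_area_def)

lemma sec_area_cases:
  fixes a :: "'a::ordered_euclidean_space"
  assumes "norm a = 1" and t: "sqrt (real DIM('a) - 1) / 2 < t"
  obtains (empty) "sec_area a t = 0"
  | (corner) v :: 'a where "norm v = 1" "\<And>b. b \<in> Basis \<Longrightarrow> 0 < v \<bullet> b" "t \<le> v \<bullet> One / 2"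
      "sec_area a t = corner_area v (v \<bullet> One / 2 - t)"
proof (cases "\<bar>a\<bar> \<bullet> One / 2 < t")
  case True
  then show thesis
    using sec_area_eq_0 empty by blast
next
  case False
  have "\<bar>a\<bar> \<bullet> \<bar>a\<bar> = a \<bullet> a"
    unfolding euclidean_inner[of "\<bar>a\<bar>" "\<bar>a\<bar>"] euclidean_inner[of a a]
    by (intro sum.cong) (auto simp: abs_inner)
  then have unit: "norm \<bar>a\<bar> = 1"
    using \<open>norm a = 1\<close> by (simp add: norm_eq_1)
  have pos: "0 < \<bar>a\<bar> \<bullet> k" if "k \<in> Basis" for k
  proof (rule ccontr)
    assume "\<not> 0 < \<bar>a\<bar> \<bullet> k"
    then have "\<bar>a\<bar> \<bullet> k = 0"
      using that by (simp add: abs_inner)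
    then have "\<bar>a\<bar> \<bullet> One = (\<Sum>b\<in>Basis - {k}. \<bar>a\<bar> \<bullet> b)"
      unfolding inner_One using that by (simp add: sum.remove)
    then show False
      using sum_Basis_minus_le[OF unit that] t False by simp
  qed
  show thesis
    using corner[OF unit pos] sec_area_corner[OF pos unit, of t] sec_area_abs[of a t] t False by simp
qed

lemma corner_area_le:
  fixes v :: "'a::euclidean_space"
  assumes "DIM('a) \<ge> 3" and unit: "norm v = 1" and pos: "\<And>b. b \<in> Basis \<Longrightarrow> 0 < v \<bullet> b"
    and t: "sqrt (real DIM('a) - 1) / 2 < t" "t \<le> v \<bullet> One / 2"
  shows "corner_area v (v \<bullet> One / 2 - t)
    \<le> sqrt (real DIM('a)) ^ DIM('a) / fact (DIM('a) - 1) * (sqrt (real DIM('a)) / 2 - t) ^ (DIM('a) - 1)"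
proof -
  have "(v \<bullet> One / 2 - t) ^ (DIM('a) - 1)
      \<le> sqrt (real DIM('a)) ^ DIM('a) * (\<Prod>b\<in>Basis. v \<bullet> b) * (sqrt (real DIM('a)) / 2 - t) ^ (DIM('a) - 1)"
    unfolding inner_One using assms sum_Basis_square_eq_1[OF unit]
    by (intro corner_depth_power_le_prod) (auto simp: inner_One)
  moreover have "(\<Prod>b\<in>Basis. v \<bullet> b) > 0"
    using pos by (rule prod_pos)
  ultimately show ?thesis
    unfolding corner_area_def by (simp add: divide_simps mult_ac)
qed

lemma diagvec_inner_Basis: "b \<in> Basis \<Longrightarrow> (diagvec :: real^'n) \<bullet> b = 1 / sqrt (real CARD('n))"
  by (auto simp: Basis_vec_def diagvec_def inner_axis)

lemma diagvec_inner_One: "(diagvec :: real^'n) \<bullet> One = sqrt (real CARD('n))"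
  by (simp add: inner_One diagvec_inner_Basis real_div_sqrt)

lemma norm_diagvec: "norm (diagvec :: real^'n) = 1"
  unfolding norm_eq_1 euclidean_inner[of "diagvec :: real^'n" diagvec]
  by (simp add: diagvec_inner_Basis)

lemma sec_area_diagvec:
  assumes "sqrt (real CARD('n) - 1) / 2 \<le> t" "t \<le> sqrt (real CARD('n)) / 2"
  shows "sec_area (diagvec :: real^'n) t
    = sqrt (real CARD('n)) ^ CARD('n) / fact (CARD('n) - 1) * (sqrt (real CARD('n)) / 2 - t) ^ (CARD('n) - 1)"
proof -
  have "(\<Prod>b\<in>Basis. (diagvec :: real^'n) \<bullet> b) = 1 / sqrt (real CARD('n)) ^ CARD('n)"
    by (simp add: diagvec_inner_Basis power_divide)
  then show ?thesis
    using assms by (subst sec_area_corner)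
      (auto simp: diagvec_inner_Basis diagvec_inner_One norm_diagvec corner_area_def)
qed

lemma sec_area_le_diagvec:
  fixes a :: "real^'n"
  assumes "CARD('n) \<ge> 3" and "norm a = 1"
    and t: "sqrt (real CARD('n) - 1) / 2 < t" "t \<le> sqrt (real CARD('n)) / 2"
  shows "sec_area a t \<le> sec_area (diagvec :: real^'n) t"
proof -
  have "sqrt (real DIM(real^'n) - 1) / 2 < t"
    using t by simp
  with \<open>norm a = 1\<close> show ?thesis
  proof (cases rule: sec_area_cases)
    case empty
    then show ?thesis
      using t by (simp add: sec_area_diagvec)
  next
    case (corner v)
    then show ?thesis
      using corner_area_le[of v t] assms by (simp add: sec_area_diagvec)
  qed
qed

section \<open>The planar case\<close>

lemma Basis_vec2: "(Basis :: (real^2) set) = {axis 1 1, axis 2 1}"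
  by (auto simp: Basis_vec_def UNIV_2)

lemma inner_One_vec2: "(v :: real^2) \<bullet> One = v $ 1 + v $ 2"
  unfolding inner_One by (simp add: Basis_vec2 axis_eq_axis inner_axis)

lemma norm_eq_1_vec2: "norm (v :: real^2) = 1 \<longleftrightarrow> (v $ 1)\<^sup>2 + (v $ 2)\<^sup>2 = 1"
  by (simp add: norm_eq_1 inner_vec_def sum_2 power2_eq_square)

lemma corner_area_vec2:
  fixes v :: "real^2"
  assumes "norm v = 1"
  shows "corner_area v h = 2 * h / ((v \<bullet> One)\<^sup>2 - 1)"
proof -
  have "(\<Prod>b\<in>Basis. v \<bullet> b) = v $ 1 * v $ 2"
    by (simp add: Basis_vec2 axis_eq_axis inner_axis)
  moreover have "(v \<bullet> One)\<^sup>2 - 1 = 2 * (v $ 1 * v $ 2)"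
    using assms by (simp add: inner_One_vec2 norm_eq_1_vec2 power2_sum)
  ultimately show ?thesis
    by (simp add: corner_area_def)
qed

lemma planar_corner_area_le_iff:
  fixes \<sigma> t :: real
  assumes "1 < \<sigma>" "\<sigma> < sqrt 2"
  shows "(\<sigma> - 2 * t) / (\<sigma>\<^sup>2 - 1) \<le> sqrt 2 - 2 * t \<longleftrightarrow> (sqrt 2 - 2 * t) * (sqrt 2 + \<sigma>) \<le> 1"
proof -
  have "(sqrt 2 - 2 * t) * (\<sigma>\<^sup>2 - 1) - (\<sigma> - 2 * t)
      = (sqrt 2 - \<sigma>) - (sqrt 2 - 2 * t) * ((sqrt 2)\<^sup>2 - \<sigma>\<^sup>2)"
    by (simp add: algebra_simps)
  also have "\<dots> = (sqrt 2 - \<sigma>) * (1 - (sqrt 2 - 2 * t) * (sqrt 2 + \<sigma>))"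
    unfolding power2_eq_square square_diff_square_factored by (simp add: algebra_simps)
  finally have "(sqrt 2 - 2 * t) * (\<sigma>\<^sup>2 - 1) - (\<sigma> - 2 * t)
      = (sqrt 2 - \<sigma>) * (1 - (sqrt 2 - 2 * t) * (sqrt 2 + \<sigma>))" .
  moreover have "0 < \<sigma>\<^sup>2 - 1"
    using assms by simp
  ultimately have "(\<sigma> - 2 * t) / (\<sigma>\<^sup>2 - 1) \<le> sqrt 2 - 2 * t
      \<longleftrightarrow> 0 \<le> (sqrt 2 - \<sigma>) * (1 - (sqrt 2 - 2 * t) * (sqrt 2 + \<sigma>))"
    by (simp add: pos_divide_le_eq) linarith
  then show ?thesis
    using assms by (simp add: zero_le_mult_iff)
qed

lemma sec_area_diagvec_vec2:
  assumes "1 / 2 \<le> t" "t \<le> sqrt 2 / 2"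
  shows "sec_area (diagvec :: real^2) t = sqrt 2 - 2 * t"
  using sec_area_diagvec[where 'n = 2, of t] assms by simp

lemma planar_corner_area_le:
  fixes \<sigma> t :: real
  assumes "1 < \<sigma>" "\<sigma> \<le> sqrt 2" and t: "3 / 8 * sqrt 2 < t" "t \<le> sqrt 2 / 2"
  shows "(\<sigma> - 2 * t) / (\<sigma>\<^sup>2 - 1) \<le> sqrt 2 - 2 * t"
proof (cases "\<sigma> = sqrt 2")
  case False
  then have "\<sigma> < sqrt 2"
    using \<open>\<sigma> \<le> sqrt 2\<close> by simp
  then have "(sqrt 2 - 2 * t) * (sqrt 2 + \<sigma>) \<le> sqrt 2 / 4 * (2 * sqrt 2)"
    using t \<open>1 < \<sigma>\<close> by (intro mult_mono) auto
  then show ?thesis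
    using planar_corner_area_le_iff[OF \<open>1 < \<sigma>\<close> \<open>\<sigma> < sqrt 2\<close>, of t] by simp
qed simp

lemma sec_area_le_diagvec_vec2:
  fixes a :: "real^2"
  assumes "norm a = 1" and t: "3 / 8 * sqrt 2 < t" "t \<le> sqrt 2 / 2"
  shows "sec_area a t \<le> sec_area (diagvec :: real^2) t"
proof -
  have "7 / 5 < sqrt (2 :: real)"
    by (rule real_less_rsqrt) (simp add: power2_eq_square)
  then have "1 / 2 < t"
    using t by simp
  then have diag: "sec_area (diagvec :: real^2) t = sqrt 2 - 2 * t"
    and "sqrt (real DIM(real^2) - 1) / 2 < t"
    using t by (simp_all add: sec_area_diagvec_vec2)
  from \<open>norm a = 1\<close> this(2) show ?thesis
  proof (cases rule: sec_area_cases)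
    case empty
    then show ?thesis
      using diag t by simp
  next
    case (corner v)
    have "v \<bullet> One \<le> sqrt 2"
      using sum_le_sqrt_card[of "\<lambda>b. v \<bullet> b" Basis] sum_Basis_square_eq_1[OF \<open>norm v = 1\<close>]
      by (simp add: inner_One)
    moreover have "1 < v \<bullet> One"
      using \<open>t \<le> v \<bullet> One / 2\<close> \<open>1 / 2 < t\<close> by simp
    ultimately show ?thesis
      using planar_corner_area_le[of "v \<bullet> One" t] t corner
      by (simp add: corner_area_vec2 diag)
  qed
qed

lemma positive_unit_vec2_with_coord_sum:
  assumes "1 < \<sigma>" "\<sigma> < sqrt 2"
  obtains v :: "real^2" where "norm v = 1" "\<And>b. b \<in> Basis \<Longrightarrow> 0 < v \<bullet> b" "v \<bullet> One = \<sigma>"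
proof -
  define r x y where "r = sqrt (2 - \<sigma>\<^sup>2)" and "x = (\<sigma> + r) / 2" and "y = (\<sigma> - r) / 2"
  have "\<sigma>\<^sup>2 < (sqrt 2)\<^sup>2"
    using assms by (intro power_strict_mono) auto
  then have r: "0 \<le> r" "r\<^sup>2 = 2 - \<sigma>\<^sup>2"
    by (auto simp: r_def)
  moreover have "1 < \<sigma>\<^sup>2"
    using assms by simp
  ultimately have "r < \<sigma>"
    using assms by (intro power2_less_imp_less[of r]) auto
  define v :: "real^2" where "v = vector [x, y]"
  show thesis
  proof
    have "x\<^sup>2 + y\<^sup>2 = 1"
      using r by (simp add: x_def y_def power2_eq_square field_simps)
    then show "norm v = 1"
      by (simp add: norm_eq_1_vec2 v_def)
    show "0 < v \<bullet> b" if "b \<in> Basis" for b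
      using that r \<open>r < \<sigma>\<close> by (auto simp: Basis_vec2 inner_axis v_def x_def y_def)
    show "v \<bullet> One = \<sigma>"
      by (simp add: inner_One_vec2 v_def x_def y_def field_simps)
  qed
qed

lemma sec_area_diagvec_vec2_not_max:
  assumes t: "1 / 2 < t" "t < 3 / 8 * sqrt 2"
  obtains a :: "real^2" where "norm a = 1" "sec_area (diagvec :: real^2) t < sec_area a t"
proof -
  define p where "p = sqrt 2 - 2 * t"
  have p: "sqrt 2 / 4 < p"
    using t by (simp add: p_def)
  moreover have "0 < sqrt 2 / (4 :: real)"
    by simp
  ultimately have "0 < p"
    by linarith
  have "1 = sqrt 2 / 4 * (2 * sqrt (2 :: real))"
    by simp
  also have "\<dots> < p * (2 * sqrt 2)"
    using p by (intro mult_strict_right_mono) auto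
  finally have "max (2 * t) (1 / p - sqrt 2) < sqrt 2"
    using \<open>0 < p\<close> by (simp add: p_def field_simps)
  then obtain \<sigma> where \<sigma>: "2 * t < \<sigma>" "1 / p - sqrt 2 < \<sigma>" "\<sigma> < sqrt 2"
    using dense by (metis max_less_iff_conj)
  then have "1 < \<sigma>"
    using t by simp
  then obtain v :: "real^2" where v: "norm v = 1" "\<And>b. b \<in> Basis \<Longrightarrow> 0 < v \<bullet> b" "v \<bullet> One = \<sigma>"
    using \<sigma> positive_unit_vec2_with_coord_sum by metis
  have "1 < p * (sqrt 2 + \<sigma>)"
    using \<sigma> \<open>0 < p\<close> by (simp add: field_simps)
  then have "sqrt 2 - 2 * t < (\<sigma> - 2 * t) / (\<sigma>\<^sup>2 - 1)"
    using planar_corner_area_le_iff[OF \<open>1 < \<sigma>\<close> \<sigma>(3), of t] by (simp add: p_def not_le)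
  moreover have "sec_area v t = (\<sigma> - 2 * t) / (\<sigma>\<^sup>2 - 1)"
    using sec_area_corner[OF v(2,1), of t] t \<sigma> by (simp add: v corner_area_vec2)
  ultimately show thesis
    using that[OF v(1)] t \<open>0 < p\<close> by (simp add: sec_area_diagvec_vec2 p_def)
qed

theorem theorem4:
  shows
  "(\<forall>(a::real^'n) t.
      CARD('n) \<ge> 3 \<and> sqrt (real CARD('n) - 1) / 2 < t \<and> t \<le> sqrt (real CARD('n)) / 2
      \<and> a \<in> sphere 0 1 \<longrightarrow>
        sec_area a t \<le> sec_area (diagvec :: real^'n) t \<and>
        sec_area (diagvec :: real^'n) t =
          real CARD('n) powr (real CARD('n) / 2) / fact (CARD('n) - 1)
            * (sqrt (real CARD('n)) / 2 - t) ^ (CARD('n) - 1))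
   \<and> (\<forall>(a::real^2) t. 3/8 * sqrt 2 < t \<and> t \<le> 1 / sqrt 2 \<and> a \<in> sphere 0 1 \<longrightarrow>
        sec_area a t \<le> sec_area (diagvec :: real^2) t)
   \<and> (\<forall>t. 1/2 < t \<and> t < 3/8 * sqrt 2 \<longrightarrow>
        (\<exists>a::real^2. a \<in> sphere 0 1 \<and> sec_area a t > sec_area (diagvec :: real^2) t))"
proof (intro conjI allI impI; elim conjE)
  fix a :: "real^'n" and t :: real
  assume "CARD('n) \<ge> 3" and t: "sqrt (real CARD('n) - 1) / 2 < t" "t \<le> sqrt (real CARD('n)) / 2"
    and "a \<in> sphere 0 1"
  then show "sec_area a t \<le> sec_area (diagvec :: real^'n) t"
    by (intro sec_area_le_diagvec) auto
  have "real CARD('n) powr (real CARD('n) / 2) = sqrt (real CARD('n)) ^ CARD('n)"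
    by (simp add: powr_half_sqrt_powr powr_realpow real_sqrt_power)
  then show "sec_area (diagvec :: real^'n) t = real CARD('n) powr (real CARD('n) / 2) / fact (CARD('n) - 1)
      * (sqrt (real CARD('n)) / 2 - t) ^ (CARD('n) - 1)"
    using t by (simp add: sec_area_diagvec)
next
  fix a :: "real^2" and t :: real
  assume "3/8 * sqrt 2 < t" "t \<le> 1 / sqrt 2" "a \<in> sphere 0 1"
  moreover have "1 / sqrt 2 = sqrt 2 / (2 :: real)"
    by (simp add: field_simps)
  ultimately show "sec_area a t \<le> sec_area (diagvec :: real^2) t"
    by (intro sec_area_le_diagvec_vec2) auto
next
  fix t :: real
  assume "1/2 < t" "t < 3/8 * sqrt 2"
  then obtain a :: "real^2" where "norm a = 1" "sec_area (diagvec :: real^2) t < sec_area a t"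
    by (rule sec_area_diagvec_vec2_not_max)
  then show "\<exists>a::real^2. a \<in> sphere 0 1 \<and> sec_area a t > sec_area (diagvec :: real^2) t"
    by auto
qed

end
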